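(* Let $f:\mathbb{R}^d\to\mathbb{R}$ be bounded below, $L$-smooth on $\mathbb{R}^d$, and upper bounded by $f_{\max}$, i.e. $f(x)\le f_{\max}$ for all $x\in\mathbb{R}^d$. Suppose the stochastic gradient oracle is unbiased and variance-bounded by $V^2$. Run SGD, $x_{t+1}=x_t-\eta_t\hat g_t$ for $t=1,\dots,T$, from any $x_1\in\mathbb{R}^d$, with step-sizes $\eta_t=\eta_0/\sqrt{t}\le 1/L$, where $\eta_0>0$. Let $\hat x_T$ be drawn at random from $\{x_t\}_{t=1}^T$ with probabilities $P_t=\frac{1/\eta_t}{\sum_{l=1}^T 1/\eta_l}$. Then $$\mathbb{E}\big[\|\nabla f(\hat x_T)\|^2\big]\le\left(\frac{3f_{\max}}{\eta_0}+\frac{3LV^2\eta_0}{2}\right)\cdot\frac{1}{\sqrt{T}}.$$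
   Context: $\|\cdot\|$ is the Euclidean norm. $f$ is $L$-smooth on $\mathbb{R}^d$ ($L>0$) if it is differentiable and $\|\nabla f(x)-\nabla f(y)\|\le L\|x-y\|$ for all $x,y\in\mathbb{R}^d$. Stochastic gradient oracle: queried at $x_t$ it returns a random vector $\hat g_t$ which (conditionally on the past of the algorithm) satisfies $\mathbb{E}[\hat g_t]=\nabla f(x_t)$. It is variance-bounded by $V^2$ if for every input, $\mathbb{E}[\|\hat g-\mathbb{E}[\hat g]\|^2]\le V^2$. The random index defining $\hat x_T$ is chosen independently of the run, and the expectation is over both the oracle randomness and this choice.
   Formalization: As stated the bound fails (f = -1 constant, f_max = -1, zero oracle, V = 0); it is proved with f_max when f is nonnegative, and for every f bounded below with f_max - inf f in place of f_max. *)

theory Defs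
  imports "HOL-Probability.Probability"
begin

definition grad :: "('a::real_inner \<Rightarrow> real) \<Rightarrow> 'a \<Rightarrow> 'a" where
  "grad f x = (THE D. GDERIV f x :> D)"

definition L_smooth :: "real \<Rightarrow> ('a::euclidean_space \<Rightarrow> real) \<Rightarrow> bool" where
  "L_smooth L f \<longleftrightarrow>
     (\<forall>x. f differentiable at x) \<and>
     (\<forall>x y. norm (grad f x - grad f y) \<le> L * norm (x - y))"

(* The past of the algorithm when it issues its t-th query: the sigma-algebra generated by the
   oracle answers g 1, ..., g (t - 1).  The starting point is deterministic and every iterate
   x s with s <= t is a function of these answers, so the iterates need not be listed. *)
definition past :: "'w measure \<Rightarrow> (nat \<Rightarrow> 'w \<Rightarrow> 'a::topological_space) \<Rightarrow> nat \<Rightarrow> 'w measure" where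
  "past M g t = sigma (space M) {g s -` A \<inter> space M | s A. s \<in> {1..<t} \<and> A \<in> sets borel}"

(* real_cond_exp is only available for real-valued functions; vectors are treated
   coordinate by coordinate. *)
definition vec_cond_exp ::
    "'w measure \<Rightarrow> 'w measure \<Rightarrow> ('w \<Rightarrow> real ^ 'd) \<Rightarrow> 'w \<Rightarrow> real ^ 'd" where
  "vec_cond_exp M F X \<omega> = (\<chi> i. real_cond_exp M F (\<lambda>\<omega>'. X \<omega>' $ i) \<omega>)"

(* Integrability is what makes the conditional expectation meaningful: real_cond_exp is total
   and returns unrelated values on non-integrable functions. *)
definition unbiased_oracle ::
    "'w measure \<Rightarrow> (real ^ 'd \<Rightarrow> real) \<Rightarrow> (nat \<Rightarrow> 'w \<Rightarrow> real ^ 'd) \<Rightarrow>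
     (nat \<Rightarrow> 'w \<Rightarrow> real ^ 'd) \<Rightarrow> nat \<Rightarrow> bool" where
  "unbiased_oracle M f x g T \<longleftrightarrow>
     (\<forall>t\<in>{1..T}. integrable M (g t) \<and>
        (AE \<omega> in M. vec_cond_exp M (past M g t) (g t) \<omega> = grad f (x t \<omega>)))"

(* The conditional variance is taken in ennreal, so the bound includes its finiteness. *)
definition variance_bounded_oracle ::
    "'w measure \<Rightarrow> (nat \<Rightarrow> 'w \<Rightarrow> real ^ 'd) \<Rightarrow> nat \<Rightarrow> real \<Rightarrow> bool" where
  "variance_bounded_oracle M g T v \<longleftrightarrow>
     (\<forall>t\<in>{1..T}. AE \<omega> in M.
        nn_cond_exp M (past M g t)
          (\<lambda>\<omega>'. ennreal ((norm (g t \<omega>' - vec_cond_exp M (past M g t) (g t) \<omega>'))\<^sup>2)) \<omega>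
        \<le> ennreal v)"

(* A random index in {1..T} with law P, independent of the whole run, i.e. of all the
   oracle answers g 1, ..., g T. *)
definition independent_index ::
    "'w measure \<Rightarrow> (nat \<Rightarrow> 'w \<Rightarrow> 'a::topological_space) \<Rightarrow> nat \<Rightarrow> (nat \<Rightarrow> real) \<Rightarrow>
     ('w \<Rightarrow> nat) \<Rightarrow> bool" where
  "independent_index M g T P \<tau> \<longleftrightarrow>
     \<tau> \<in> measurable M (count_space {1..T}) \<and>
     (\<forall>t\<in>{1..T}. measure M {\<omega> \<in> space M. \<tau> \<omega> = t} = P t) \<and>
     prob_space.indep_set M
       (sets (vimage_algebra (space M) \<tau> (count_space {1..T})))
       (sets (past M g (Suc T)))"

end

theory Submission
  imports Defs
begin

text \<open>By the descent lemma, \<open>\<eta>\<^sub>t \<le> 1/L\<close> and unbiasedness,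
  \<open>\<eta>\<^sub>t/2 * E|\<nabla>f(x\<^sub>t)|^2 \<le> E f(x\<^sub>t) - E f(x\<^sub>t\<^sub>+\<^sub>1) + L \<eta>\<^sub>t^2 V^2/2\<close>.
  Dividing by \<open>\<eta>\<^sub>t^2/2\<close> weights the differences of \<open>E f(x\<^sub>t)\<close> by \<open>2t/\<eta>\<^sub>0^2\<close>; summation by parts
  bounds their sum by \<open>2T/\<eta>\<^sub>0^2\<close> times the oscillation of \<open>f\<close>. The normalising constant of the
  \<open>P\<^sub>t\<close> is \<open>(\<Sum> sqrt t)/\<eta>\<^sub>0\<close>, at least \<open>2 T sqrt T / (3 \<eta>\<^sub>0)\<close>. Integrability of the
  gradients holds because a smooth bounded function has a bounded gradient.\<close>

section \<open>Smooth functions\<close>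

text \<open>Justifies the definite description in \<open>grad\<close>: the Riesz representative of
  the derivative, built from its values on the orthonormal basis, is a gradient, and uniqueness of
  derivatives makes it the only one.\<close>

lemma GDERIV_grad:
  fixes f :: "'a::euclidean_space \<Rightarrow> real"
  assumes "f differentiable at x"
  shows "GDERIV f x :> grad f x"
proof -
  obtain f' where f': "(f has_derivative f') (at x)"
    using assms unfolding differentiable_def by auto
  interpret f': bounded_linear f' using f' by (rule has_derivative_bounded_linear)
  define D where "D = (\<Sum>b\<in>Basis. f' b *\<^sub>R b)"
  have "f' h = h \<bullet> D" for h
  proof -
    have "f' h = f' (\<Sum>b\<in>Basis. (h \<bullet> b) *\<^sub>R b)"
      by (simp add: euclidean_representation)
    also have "\<dots> = (\<Sum>b\<in>Basis. (h \<bullet> b) * f' b)"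
      by (simp add: f'.sum f'.scaleR)
    also have "\<dots> = h \<bullet> D"
      by (simp add: D_def inner_sum_right mult.commute)
    finally show ?thesis .
  qed
  then have "f' = (\<lambda>h. h \<bullet> D)" by blast
  with f' have D: "GDERIV f x :> D" by (simp add: gderiv_def)
  have "E = D" if "GDERIV f x :> E" for E
  proof -
    have "(\<lambda>h. h \<bullet> E) = (\<lambda>h. h \<bullet> D)"
      using that D unfolding gderiv_def by (rule has_derivative_unique)
    then have "\<forall>h. h \<bullet> E = h \<bullet> D" by metis
    then show ?thesis by (simp only: vector_eq_ldot)
  qed
  with D show ?thesis unfolding grad_def by (rule theI)
qed

text \<open>Along the segment from \<open>x\<close> to \<open>x + d\<close>, let
  \<open>\<phi>\<close> be \<open>f\<close> minus its quadratic upper model. Cauchy-Schwarz and the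
  Lipschitz gradient make the derivative of \<open>\<phi>\<close> nonpositive, so comparing the
  endpoints gives the claim.\<close>

lemma descent_lemma:
  assumes "L_smooth L f"
  shows "f (x + d) \<le> f x + grad f x \<bullet> d + L / 2 * (norm d)\<^sup>2"
proof -
  define \<phi> where "\<phi> s = f (x + s *\<^sub>R d) - s * (grad f x \<bullet> d) - L / 2 * s\<^sup>2 * (norm d)\<^sup>2" for s
  define \<phi>' where "\<phi>' s = d \<bullet> grad f (x + s *\<^sub>R d) - grad f x \<bullet> d - L * s * (norm d)\<^sup>2" for s
  have "\<phi> 1 \<le> \<phi> 0"
  proof (rule DERIV_nonpos_imp_nonincreasing[of 0 1])
    fix s :: real assume s: "0 \<le> s" "s \<le> 1"
    have "GDERIV f (x + s *\<^sub>R d) :> grad f (x + s *\<^sub>R d)"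
      using assms GDERIV_grad unfolding L_smooth_def by blast
    then have f: "(f has_derivative (\<lambda>h. h \<bullet> grad f (x + s *\<^sub>R d))) (at (x + s *\<^sub>R d))"
      by (simp add: gderiv_def)
    have "((\<lambda>s. x + s *\<^sub>R d) has_derivative (\<lambda>h. h *\<^sub>R d)) (at s)"
      by (auto intro!: derivative_eq_intros)
    from has_derivative_compose[OF this f]
    have "((\<lambda>s. f (x + s *\<^sub>R d)) has_real_derivative d \<bullet> grad f (x + s *\<^sub>R d)) (at s)"
      by (simp add: has_field_derivative_def mult.commute[of _ "d \<bullet> _"])
    then have "DERIV \<phi> s :> \<phi>' s"
      unfolding \<phi>_def \<phi>'_def
      by (auto intro!: derivative_eq_intros simp: algebra_simps)
    moreover have "\<phi>' s \<le> 0"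
    proof -
      have "d \<bullet> grad f (x + s *\<^sub>R d) - grad f x \<bullet> d = (grad f (x + s *\<^sub>R d) - grad f x) \<bullet> d"
        by (simp add: inner_diff_right inner_commute[of _ d])
      also have "\<dots> \<le> norm (grad f (x + s *\<^sub>R d) - grad f x) * norm d"
        by (rule norm_cauchy_schwarz)
      also have "\<dots> \<le> (L * norm (x + s *\<^sub>R d - x)) * norm d"
        using assms unfolding L_smooth_def by (intro mult_right_mono norm_ge_zero) blast
      also have "\<dots> = L * s * (norm d)\<^sup>2"
        using s by (simp add: power2_eq_square)
      finally show ?thesis by (simp add: \<phi>'_def)
    qed
    ultimately show "\<exists>y. DERIV \<phi> s :> y \<and> y \<le> 0" by blast
  qed simp
  then show ?thesis by (simp add: \<phi>_def)
qed

lemma L_smooth_continuous_on: "L_smooth L f \<Longrightarrow> continuous_on UNIV f"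
  unfolding L_smooth_def
  by (simp add: continuous_at_imp_continuous_on differentiable_imp_continuous_within)

lemma L_smooth_continuous_on_grad:
  assumes "L_smooth L f" "L > 0"
  shows "continuous_on UNIV (grad f)"
proof -
  have "L-lipschitz_on UNIV (grad f)"
    using assms by (intro lipschitz_onI) (auto simp: L_smooth_def dist_norm)
  then show ?thesis by (rule lipschitz_on_continuous_on)
qed

text \<open>A gradient step of length \<open>1 / L\<close> lowers \<open>f\<close> by at least the
  squared gradient norm over \<open>2 * L\<close>, and no step can lower \<open>f\<close> by more
  than \<open>u - m\<close>. This supplies the integrability of every gradient term.\<close>

lemma L_smooth_grad_bound:
  assumes "L_smooth L f" "L > 0" "\<And>y. m \<le> f y" "\<And>y. f y \<le> u"
  shows "(norm (grad f x))\<^sup>2 \<le> 2 * L * (u - m)"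
proof -
  let ?G = "grad f x"
  have "m \<le> f (x + (- (1 / L)) *\<^sub>R ?G)" by fact
  also have "\<dots> \<le> f x + ?G \<bullet> ((- (1 / L)) *\<^sub>R ?G) + L / 2 * (norm ((- (1 / L)) *\<^sub>R ?G))\<^sup>2"
    by (rule descent_lemma) fact
  also have "\<dots> = f x - 1 / (2 * L) * (norm ?G)\<^sup>2"
    using \<open>L > 0\<close> by (simp add: dot_square_norm power_mult_distrib power2_eq_square field_simps)
  finally have "1 / (2 * L) * (norm ?G)\<^sup>2 \<le> u - m" using assms(4)[of x] by linarith
  then show ?thesis using \<open>L > 0\<close> by (simp add: field_simps)
qed

section \<open>The expected decrease in one step\<close>

lemma borel_measurable_vec_lambda:
  fixes h :: "'i::finite \<Rightarrow> 'w \<Rightarrow> real"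
  assumes "\<And>i. h i \<in> borel_measurable M"
  shows "(\<lambda>\<omega>. \<chi> i. h i \<omega>) \<in> borel_measurable M"
  by (subst borel_measurable_euclidean_space) (use assms in \<open>auto simp: Basis_vec_def inner_axis\<close>)

text \<open>Since \<open>X\<close> is known given \<open>F\<close>, it can be pulled out of the
  conditional expectation of \<open>g\<close>, which is \<open>X\<close> itself. Hence the noise
  \<open>g - X\<close> is orthogonal to \<open>X\<close> in mean. The argument runs coordinatewise
  because \<open>vec_cond_exp\<close> is defined that way.\<close>

lemma integral_inner_noise_eq_0:
  fixes X g :: "'w \<Rightarrow> real ^ 'd"
  assumes "sigma_finite_subalgebra M F"
    and X [measurable]: "X \<in> borel_measurable F"
    and bounded: "\<And>\<omega>. norm (X \<omega>) \<le> B"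
    and g: "integrable M g"
    and mean: "AE \<omega> in M. vec_cond_exp M F g \<omega> = X \<omega>"
  shows "integrable M (\<lambda>\<omega>. X \<omega> \<bullet> (g \<omega> - X \<omega>))"
    and "(\<integral>\<omega>. X \<omega> \<bullet> (g \<omega> - X \<omega>) \<partial>M) = 0"
proof -
  interpret sigma_finite_subalgebra M F by fact
  have XM [measurable]: "X \<in> borel_measurable M"
    using subalg X by (rule measurable_from_subalg)
  have gM [measurable]: "g \<in> borel_measurable M" using g by simp
  have gi: "integrable M (\<lambda>\<omega>. g \<omega> $ i)" for i
    using integrable_inner_left[OF g, of "axis i 1"] by (simp add: inner_axis)
  have XiF: "(\<lambda>\<omega>. X \<omega> $ i) \<in> borel_measurable F" for i
    using borel_measurable_inner[OF X, of "\<lambda>_. axis i 1"] by (simp add: inner_axis)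
  have XiM [measurable]: "(\<lambda>\<omega>. X \<omega> $ i) \<in> borel_measurable M" for i
    using subalg XiF by (rule measurable_from_subalg)
  have Xi: "\<bar>X \<omega> $ i\<bar> \<le> B" for \<omega> i
    using component_le_norm_cart[of "X \<omega>" i] bounded[of \<omega>] by simp
  have B: "0 \<le> B" using norm_ge_zero bounded by (rule order_trans)
  have ce: "AE \<omega> in M. real_cond_exp M F (\<lambda>\<omega>. g \<omega> $ i) \<omega> = X \<omega> $ i" for i
    using mean by eventually_elim (simp add: vec_cond_exp_def vec_eq_iff)
  \<comment> \<open>Boundedness of \<open>X\<close> replaces square integrability of
    \<open>g\<close>: the product is dominated by a multiple of the integrable coordinate of
    \<open>g\<close>.\<close>
  have int1: "integrable M (\<lambda>\<omega>. X \<omega> $ i * g \<omega> $ i)" for i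
    by (rule Bochner_Integration.integrable_bound[where f = "\<lambda>\<omega>. B * g \<omega> $ i"])
      (use Xi B gi in \<open>auto simp: abs_mult intro!: mult_right_mono\<close>)
  note ce_int = real_cond_exp_intg[OF int1 XiF borel_measurable_integrable[OF gi]]
  have int2: "integrable M (\<lambda>\<omega>. X \<omega> $ i * X \<omega> $ i)"
    and eq: "(\<integral>\<omega>. X \<omega> $ i * X \<omega> $ i \<partial>M) = (\<integral>\<omega>. X \<omega> $ i * g \<omega> $ i \<partial>M)" for i
  proof -
    have ae: "AE \<omega> in M. X \<omega> $ i * real_cond_exp M F (\<lambda>\<omega>. g \<omega> $ i) \<omega> = X \<omega> $ i * X \<omega> $ i"
      using ce[of i] by eventually_elim simp
    show "integrable M (\<lambda>\<omega>. X \<omega> $ i * X \<omega> $ i)"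
      using ce_int(1)[of i] by (rule integrable_cong_AE_imp) (use ae in \<open>auto\<close>)
    have "(\<integral>\<omega>. X \<omega> $ i * X \<omega> $ i \<partial>M) = (\<integral>\<omega>. X \<omega> $ i * real_cond_exp M F (\<lambda>\<omega>. g \<omega> $ i) \<omega> \<partial>M)"
      by (rule integral_cong_AE) (use ae in auto)
    then show "(\<integral>\<omega>. X \<omega> $ i * X \<omega> $ i \<partial>M) = (\<integral>\<omega>. X \<omega> $ i * g \<omega> $ i \<partial>M)"
      using ce_int(2)[of i] by simp
  qed
  have inner: "X \<omega> \<bullet> (g \<omega> - X \<omega>) = (\<Sum>i\<in>UNIV. X \<omega> $ i * g \<omega> $ i - X \<omega> $ i * X \<omega> $ i)" for \<omega>
    by (simp add: inner_vec_def right_diff_distrib)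
  show "integrable M (\<lambda>\<omega>. X \<omega> \<bullet> (g \<omega> - X \<omega>))"
    unfolding inner using int1 int2 by auto
  show "(\<integral>\<omega>. X \<omega> \<bullet> (g \<omega> - X \<omega>) \<partial>M) = 0"
    unfolding inner using int1 int2 eq by (simp add: Bochner_Integration.integral_sum)
qed

text \<open>Integrating the conditional variance bound removes the conditioning. Working in
  \<open>ennreal\<close> first gives finiteness, hence integrability, and only then is the bound
  carried over to the Bochner integral.\<close>

lemma noise_second_moment:
  fixes X g :: "'w \<Rightarrow> real ^ 'd"
  assumes "prob_space M" "sigma_finite_subalgebra M F" "v \<ge> 0"
    and [measurable]: "X \<in> borel_measurable M" "g \<in> borel_measurable M"
    and mean: "AE \<omega> in M. vec_cond_exp M F g \<omega> = X \<omega>"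
    and var: "AE \<omega> in M. nn_cond_exp M F
      (\<lambda>\<omega>'. ennreal ((norm (g \<omega>' - vec_cond_exp M F g \<omega>'))\<^sup>2)) \<omega> \<le> ennreal v"
  shows "integrable M (\<lambda>\<omega>. (norm (g \<omega> - X \<omega>))\<^sup>2)"
    and "(\<integral>\<omega>. (norm (g \<omega> - X \<omega>))\<^sup>2 \<partial>M) \<le> v"
proof -
  interpret prob_space M by fact
  interpret sigma_finite_subalgebra M F by fact
  let ?N = "\<lambda>\<omega>. ennreal ((norm (g \<omega> - vec_cond_exp M F g \<omega>))\<^sup>2)"
  have [measurable]: "(\<lambda>\<omega>. vec_cond_exp M F g \<omega>) \<in> borel_measurable M"
    unfolding vec_cond_exp_def
    by (rule borel_measurable_vec_lambda) measurable
  have [measurable]: "?N \<in> borel_measurable M" by measurable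
  have "(\<integral>\<^sup>+\<omega>. ennreal ((norm (g \<omega> - X \<omega>))\<^sup>2) \<partial>M) = (\<integral>\<^sup>+\<omega>. ?N \<omega> \<partial>M)"
    by (rule nn_integral_cong_AE) (use mean in \<open>eventually_elim, simp\<close>)
  \<comment> \<open>The law of total expectation, obtained by testing the conditional expectation
    against the constant 1.\<close>
  also have "\<dots> = (\<integral>\<^sup>+\<omega>. nn_cond_exp M F ?N \<omega> \<partial>M)"
    using nn_cond_exp_intg[of "\<lambda>_. 1" ?N] by simp
  also have "\<dots> \<le> (\<integral>\<^sup>+\<omega>. ennreal v \<partial>M)"
    by (rule nn_integral_mono_AE) (rule var)
  also have "\<dots> = ennreal v" by (simp add: emeasure_space_1)
  finally have le: "(\<integral>\<^sup>+\<omega>. ennreal ((norm (g \<omega> - X \<omega>))\<^sup>2) \<partial>M) \<le> ennreal v" .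
  then show int: "integrable M (\<lambda>\<omega>. (norm (g \<omega> - X \<omega>))\<^sup>2)"
    by (intro integrableI_bounded) (auto intro: order.strict_trans1)
  have "ennreal (\<integral>\<omega>. (norm (g \<omega> - X \<omega>))\<^sup>2 \<partial>M) \<le> ennreal v"
    using le by (subst (asm) nn_integral_eq_integral[OF int]) auto
  then show "(\<integral>\<omega>. (norm (g \<omega> - X \<omega>))\<^sup>2 \<partial>M) \<le> v"
    using \<open>v \<ge> 0\<close> by simp
qed

text \<open>The descent lemma is applied to the displacement \<open>- h *\<^sub>R g\<close> with
  \<open>g\<close> split into gradient and noise. In expectation the mixed term vanishes and the
  squared noise costs at most \<open>v\<close>.\<close>

lemma expected_descent:
  fixes f :: "real ^ 'd \<Rightarrow> real" and X g :: "'w \<Rightarrow> real ^ 'd"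
  assumes "prob_space M" "subalgebra M F"
    and smooth: "L_smooth L f" "L > 0" and low: "\<And>y. m \<le> f y" and up: "\<And>y. f y \<le> u"
    and X: "X \<in> borel_measurable F" and g: "integrable M g"
    and mean: "AE \<omega> in M. vec_cond_exp M F g \<omega> = grad f (X \<omega>)"
    and var: "AE \<omega> in M. nn_cond_exp M F
      (\<lambda>\<omega>'. ennreal ((norm (g \<omega>' - vec_cond_exp M F g \<omega>'))\<^sup>2)) \<omega> \<le> ennreal v"
    and "v \<ge> 0" and h: "0 < h" "h \<le> 1 / L"
  shows "h / 2 * (\<integral>\<omega>. (norm (grad f (X \<omega>)))\<^sup>2 \<partial>M)
    \<le> (\<integral>\<omega>. f (X \<omega>) \<partial>M) - (\<integral>\<omega>. f (X \<omega> - h *\<^sub>R g \<omega>) \<partial>M) + L * h\<^sup>2 * v / 2"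
proof -
  interpret prob_space M by fact
  \<comment> \<open>Every subalgebra of a finite measure space is sigma-finite, as the conditional
    expectation lemmas require.\<close>
  interpret finite_measure_subalgebra M F by unfold_locales fact
  have [measurable]: "f \<in> borel_measurable borel" "grad f \<in> borel_measurable borel"
    using L_smooth_continuous_on[OF smooth(1)] L_smooth_continuous_on_grad[OF smooth]
    by (auto intro: borel_measurable_continuous_onI)
  have XM [measurable]: "X \<in> borel_measurable M"
    using subalg X by (rule measurable_from_subalg)
  have gM [measurable]: "g \<in> borel_measurable M" using g by simp
  define G where "G \<omega> = grad f (X \<omega>)" for \<omega>
  define e where "e \<omega> = g \<omega> - G \<omega>" for \<omega>
  have GF: "G \<in> borel_measurable F" unfolding G_def using X by measurable
  have GM [measurable]: "G \<in> borel_measurable M"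
    using subalg GF by (rule measurable_from_subalg)
  have Gsq: "(norm (G \<omega>))\<^sup>2 \<le> 2 * L * (u - m)" for \<omega>
    unfolding G_def by (rule L_smooth_grad_bound[OF smooth low up])
  have Gb: "norm (G \<omega>) \<le> sqrt (2 * L * (u - m))" for \<omega>
    using Gsq by (rule real_le_rsqrt)
  have mean': "AE \<omega> in M. vec_cond_exp M F g \<omega> = G \<omega>" using mean by (simp add: G_def)
  note cross = integral_inner_noise_eq_0[OF sigma_finite_subalgebra_axioms GF Gb g mean', folded e_def]
  note noise = noise_second_moment[OF \<open>prob_space M\<close> sigma_finite_subalgebra_axioms \<open>v \<ge> 0\<close> GM gM
      mean' var, folded e_def]
  \<comment> \<open>Needed at both the current and the next iterate; the two-sided bound on
    \<open>f\<close> covers any measurable argument.\<close>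
  have intf: "integrable M (\<lambda>\<omega>. f (Y \<omega>))" if [measurable]: "Y \<in> borel_measurable M" for Y
  proof (rule integrable_const_bound[where B = "\<bar>m\<bar> + \<bar>u\<bar>"])
    have "\<bar>f y\<bar> \<le> \<bar>m\<bar> + \<bar>u\<bar>" for y using low[of y] up[of y] by linarith
    then show "AE \<omega> in M. norm (f (Y \<omega>)) \<le> \<bar>m\<bar> + \<bar>u\<bar>" by simp
  qed measurable
  have intG: "integrable M (\<lambda>\<omega>. (norm (G \<omega>))\<^sup>2)"
    by (rule integrable_const_bound[where B = "2 * L * (u - m)"]) (use Gsq in auto)
  \<comment> \<open>The step size restriction enters here: half of the first-order decrease
    \<open>h * (norm (G \<omega>))\<^sup>2\<close> then pays for the quadratic term in
    \<open>G\<close>.\<close>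
  have Lh: "L * h\<^sup>2 \<le> h"
    using h \<open>L > 0\<close> by (simp add: power2_eq_square field_simps)
  \<comment> \<open>The mixed term \<open>G \<omega> \<bullet> e \<omega>\<close> is kept exactly,
    since it has no sign pointwise and disappears only after integration.\<close>
  have step: "f (X \<omega> - h *\<^sub>R g \<omega>) \<le> f (X \<omega>) - h / 2 * (norm (G \<omega>))\<^sup>2
      + (L * h\<^sup>2 - h) * (G \<omega> \<bullet> e \<omega>) + L * h\<^sup>2 / 2 * (norm (e \<omega>))\<^sup>2" for \<omega>
  proof -
    have "f (X \<omega> - h *\<^sub>R g \<omega>)
        \<le> f (X \<omega>) + G \<omega> \<bullet> (- (h *\<^sub>R g \<omega>)) + L / 2 * (norm (- (h *\<^sub>R g \<omega>)))\<^sup>2"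
      using descent_lemma[OF smooth(1), of "X \<omega>" "- (h *\<^sub>R g \<omega>)"] by (simp add: G_def)
    also have "\<dots> = f (X \<omega>) - h * (norm (G \<omega>))\<^sup>2 + L * h\<^sup>2 / 2 * (norm (G \<omega>))\<^sup>2
        + (L * h\<^sup>2 - h) * (G \<omega> \<bullet> e \<omega>) + L * h\<^sup>2 / 2 * (norm (e \<omega>))\<^sup>2"
    proof -
      have "g \<omega> = G \<omega> + e \<omega>" by (simp add: e_def)
      then show ?thesis
        by (simp add: power2_norm_eq_inner inner_add_left inner_add_right inner_commute algebra_simps power2_eq_square[of h])
    qed
    also have "L * h\<^sup>2 / 2 * (norm (G \<omega>))\<^sup>2 \<le> h / 2 * (norm (G \<omega>))\<^sup>2"
      using Lh by (intro mult_right_mono) auto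
    finally show ?thesis by simp
  qed
  have "(\<integral>\<omega>. f (X \<omega> - h *\<^sub>R g \<omega>) \<partial>M) \<le> (\<integral>\<omega>. f (X \<omega>) - h / 2 * (norm (G \<omega>))\<^sup>2
      + (L * h\<^sup>2 - h) * (G \<omega> \<bullet> e \<omega>) + L * h\<^sup>2 / 2 * (norm (e \<omega>))\<^sup>2 \<partial>M)"
    by (rule integral_mono) (use intf intG cross(1) noise(1) step in auto)
  also have "\<dots> = (\<integral>\<omega>. f (X \<omega>) \<partial>M) - h / 2 * (\<integral>\<omega>. (norm (G \<omega>))\<^sup>2 \<partial>M)
      + L * h\<^sup>2 / 2 * (\<integral>\<omega>. (norm (e \<omega>))\<^sup>2 \<partial>M)"
    using intf[OF XM] intG cross noise(1) by simp
  also have "L * h\<^sup>2 / 2 * (\<integral>\<omega>. (norm (e \<omega>))\<^sup>2 \<partial>M) \<le> L * h\<^sup>2 / 2 * v"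
    using noise(2) \<open>L > 0\<close> by (intro mult_left_mono) auto
  finally show ?thesis by (simp add: G_def)
qed

section \<open>The past of the run and the random index\<close>

lemma space_past [simp]: "space (past M g t) = space M"
  unfolding past_def by (rule space_measure_of) auto

lemma sets_past: "sets (past M g t) =
    sigma_sets (space M) {g s -` A \<inter> space M | s A. s \<in> {1..<t} \<and> A \<in> sets borel}"
  unfolding past_def by (rule sets_measure_of) auto

lemma subalgebra_past:
  assumes "\<And>s. s \<in> {1..<t} \<Longrightarrow> g s \<in> borel_measurable M"
  shows "subalgebra M (past M g t)"
  unfolding subalgebra_def
proof (intro conjI)
  show "sets (past M g t) \<subseteq> sets M"
    unfolding sets_past using assms by (intro sets.sigma_sets_subset) (auto intro: measurable_sets)
qed simp

lemma subalgebra_past_mono: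
  assumes "s \<le> t"
  shows "subalgebra (past M g t) (past M g s)"
  unfolding subalgebra_def
proof (intro conjI)
  show "sets (past M g s) \<subseteq> sets (past M g t)"
    unfolding sets_past by (rule sigma_sets_mono') (use assms in fastforce)
qed simp

lemma measurable_past:
  assumes "s \<in> {1..<t}"
  shows "g s \<in> borel_measurable (past M g t)"
proof (rule measurableI)
  fix A :: "'b set" assume "A \<in> sets borel"
  then show "g s -` A \<inter> space (past M g t) \<in> sets (past M g t)"
    using assms unfolding sets_past space_past by (intro sigma_sets.Basic) blast
qed simp

text \<open>By induction, \<open>x t\<close> depends only on the answers \<open>g 1\<close>, ...,
  \<open>g (t - 1)\<close>, which are exactly those generating \<open>past M g t\<close>. The range
  includes \<open>Suc T\<close>, the point reached after the last update.\<close>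

lemma iterate_measurable_past:
  fixes x g :: "nat \<Rightarrow> 'w \<Rightarrow> 'a::euclidean_space"
  assumes "\<And>\<omega>. \<omega> \<in> space M \<Longrightarrow> x 1 \<omega> = x\<^sub>1"
    and "\<And>t \<omega>. t \<in> {1..T} \<Longrightarrow> \<omega> \<in> space M \<Longrightarrow> x (Suc t) \<omega> = x t \<omega> - \<eta> t *\<^sub>R g t \<omega>"
    and "t \<in> {1..Suc T}"
  shows "x t \<in> borel_measurable (past M g t)"
proof -
  have "1 \<le> t" "t \<le> Suc T" using assms(3) by auto
  then show ?thesis
  proof (induction t rule: dec_induct)
    case base
    \<comment> \<open>The start and the updates are prescribed only on \<open>space M\<close>, so
      measurability is transferred by congruence on the space.\<close>
    have "x 1 \<in> borel_measurable (past M g 1) \<longleftrightarrow> (\<lambda>_. x\<^sub>1) \<in> borel_measurable (past M g 1)"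
      by (rule measurable_cong) (use assms(1) in auto)
    then show ?case by simp
  next
    case (step t)
    have [measurable]: "x t \<in> borel_measurable (past M g (Suc t))"
      by (rule measurable_from_subalg[OF subalgebra_past_mono step.IH]) (use step.prems in simp_all)
    have [measurable]: "g t \<in> borel_measurable (past M g (Suc t))"
      using step by (intro measurable_past) auto
    have "x (Suc t) \<in> borel_measurable (past M g (Suc t)) \<longleftrightarrow>
        (\<lambda>\<omega>. x t \<omega> - \<eta> t *\<^sub>R g t \<omega>) \<in> borel_measurable (past M g (Suc t))"
      by (rule measurable_cong) (use assms(2) step in auto)
    then show ?case by simp
  qed
qed

text \<open>Independence passes to the smaller sigma-algebras generated by the indicator of
  \<open>S\<close> and by \<open>Z\<close>. These are then independent random variables, and the
  expectation of their product factorises.\<close>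

lemma (in prob_space) integral_indicator_indep:
  fixes Z :: "'a \<Rightarrow> real"
  assumes indep: "indep_set (sets A) (sets B)"
    and A: "subalgebra M A" and B: "subalgebra M B"
    and S: "S \<in> sets A" and Z: "Z \<in> borel_measurable B" "integrable M Z"
  shows "integrable M (\<lambda>\<omega>. indicator S \<omega> * Z \<omega>)"
    and "(\<integral>\<omega>. indicator S \<omega> * Z \<omega> \<partial>M) = measure M S * (\<integral>\<omega>. Z \<omega> \<partial>M)"
proof -
  have SM: "S \<in> sets M" using S A by (auto simp: subalgebra_def)
  have spA: "space A = space M" and spB: "space B = space M"
    using A B by (auto simp: subalgebra_def)
  let ?I = "indicator S :: 'a \<Rightarrow> real"
  have IA: "?I \<in> borel_measurable A" using S by simp
  have ZM: "Z \<in> borel_measurable M" using Z by simp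
  have "sigma_sets (space M) {?I -` C \<inter> space M | C. C \<in> sets borel} \<subseteq> sets A"
    using measurable_sets[OF IA] unfolding spA[symmetric]
    by (intro sets.sigma_sets_subset) auto
  moreover have "sigma_sets (space M) {Z -` C \<inter> space M | C. C \<in> sets borel} \<subseteq> sets B"
    using measurable_sets[OF Z(1)] unfolding spB[symmetric]
    by (intro sets.sigma_sets_subset) auto
  ultimately have "indep_set (sigma_sets (space M) {?I -` C \<inter> space M | C. C \<in> sets borel})
      (sigma_sets (space M) {Z -` C \<inter> space M | C. C \<in> sets borel})"
    using indep unfolding indep_set_def
    by (elim indep_sets_mono_sets) (auto split: bool.split)
  then have iv: "indep_var borel ?I borel Z"
    unfolding indep_var_eq using SM ZM by simp
  have I: "integrable M ?I" using SM by (simp add: emeasure_eq_measure)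
  show "integrable M (\<lambda>\<omega>. ?I \<omega> * Z \<omega>)"
    by (rule indep_var_integrable[OF iv I Z(2)])
  show "(\<integral>\<omega>. ?I \<omega> * Z \<omega> \<partial>M) = measure M S * (\<integral>\<omega>. Z \<omega> \<partial>M)"
    using indep_var_lebesgue_integral[OF iv I Z(2)] SM sets.sets_into_space[OF SM] by (simp add: Int_absorb2)
qed

text \<open>Splitting over the values of \<open>\<tau>\<close> writes
  \<open>Z (\<tau> \<omega>) \<omega>\<close> as a finite sum of indicators times
  \<open>Z t\<close>. Each summand factorises because \<open>past M g (Suc T)\<close> contains all
  the answers up to \<open>g T\<close> and is independent of \<open>\<tau>\<close>.\<close>

lemma independent_index_expectation:
  fixes Z :: "nat \<Rightarrow> 'w \<Rightarrow> real"
  assumes "prob_space M" and ind: "independent_index M g T P \<tau>"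
    and g: "\<And>t. t \<in> {1..T} \<Longrightarrow> g t \<in> borel_measurable M"
    and Z: "\<And>t. t \<in> {1..T} \<Longrightarrow> Z t \<in> borel_measurable (past M g (Suc T))"
      "\<And>t. t \<in> {1..T} \<Longrightarrow> integrable M (Z t)"
  shows "integrable M (\<lambda>\<omega>. Z (\<tau> \<omega>) \<omega>)"
    and "(\<integral>\<omega>. Z (\<tau> \<omega>) \<omega> \<partial>M) = (\<Sum>t=1..T. P t * (\<integral>\<omega>. Z t \<omega> \<partial>M))"
proof -
  interpret prob_space M by fact
  let ?A = "vimage_algebra (space M) \<tau> (count_space {1..T})"
  define S where "S t = {\<omega> \<in> space M. \<tau> \<omega> = t}" for t
  have \<tau>: "\<tau> \<in> measurable M (count_space {1..T})"
    and P: "\<And>t. t \<in> {1..T} \<Longrightarrow> measure M (S t) = P t"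
    and indep: "indep_set (sets ?A) (sets (past M g (Suc T)))"
    using ind by (auto simp: independent_index_def S_def)
  have \<tau>T: "\<tau> \<omega> \<in> {1..T}" if "\<omega> \<in> space M" for \<omega>
    using measurable_space[OF \<tau> that] by simp
  have A: "subalgebra M ?A"
    using \<tau> by (simp add: subalgebra_def measurable_iff_sets)
  have B: "subalgebra M (past M g (Suc T))" by (rule subalgebra_past) (use g in auto)
  have SA: "S t \<in> sets ?A" if "t \<in> {1..T}" for t
  proof -
    have "S t = \<tau> -` {t} \<inter> space M" by (auto simp: S_def)
    then show ?thesis using in_vimage_algebra[of "{t}" "count_space {1..T}" \<tau> "space M"] that by simp
  qed
  note piece = integral_indicator_indep[OF indep A B SA Z(1) Z(2)]
  have eq: "Z (\<tau> \<omega>) \<omega> = (\<Sum>t=1..T. indicator (S t) \<omega> * Z t \<omega>)" if "\<omega> \<in> space M" for \<omega>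
  proof -
    have "(\<Sum>t=1..T. indicator (S t) \<omega> * Z t \<omega>) = (\<Sum>t=1..T. if t = \<tau> \<omega> then Z t \<omega> else 0)"
      by (rule sum.cong) (use that in \<open>auto simp: S_def split: split_indicator\<close>)
    then show ?thesis using \<tau>T[OF that] by simp
  qed
  have int: "integrable M (\<lambda>\<omega>. \<Sum>t=1..T. indicator (S t) \<omega> * Z t \<omega>)"
    by (rule Bochner_Integration.integrable_sum) (rule piece(1))
  then show "integrable M (\<lambda>\<omega>. Z (\<tau> \<omega>) \<omega>)"
    by (rule iffD2[OF Bochner_Integration.integrable_cong[OF refl eq], rotated])
  have "(\<integral>\<omega>. Z (\<tau> \<omega>) \<omega> \<partial>M) = (\<integral>\<omega>. (\<Sum>t=1..T. indicator (S t) \<omega> * Z t \<omega>) \<partial>M)"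
    by (rule Bochner_Integration.integral_cong[OF refl eq])
  also have "\<dots> = (\<Sum>t=1..T. \<integral>\<omega>. indicator (S t) \<omega> * Z t \<omega> \<partial>M)"
    by (rule Bochner_Integration.integral_sum) (rule piece(1))
  also have "\<dots> = (\<Sum>t=1..T. P t * (\<integral>\<omega>. Z t \<omega> \<partial>M))"
    by (rule sum.cong) (use piece(2) P in auto)
  finally show "(\<integral>\<omega>. Z (\<tau> \<omega>) \<omega> \<partial>M) = (\<Sum>t=1..T. P t * (\<integral>\<omega>. Z t \<omega> \<partial>M))" .
qed

section \<open>Averaging with weights inverse to the step sizes\<close>

text \<open>A discrete counterpart of integrating the square root from 0 to \<open>n\<close>. It is
  this lower bound on the normalising constant that produces the factor 3 in the final rate.\<close>

lemma sum_sqrt_ge: "2 / 3 * (real n * sqrt (real n)) \<le> (\<Sum>l=1..n. sqrt (real l))"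
proof (induction n)
  case (Suc n)
  define a b where "a = sqrt (real n)" and "b = sqrt (real (Suc n))"
  have ab: "0 \<le> a" "a \<le> b" "0 < b" and a2: "real n = a\<^sup>2" and b2: "real (Suc n) = b\<^sup>2"
    by (auto simp: a_def b_def)
  have eq: "b\<^sup>2 = a\<^sup>2 + 1" using a2 b2 by simp
  \<comment> \<open>This is the cubic \<open>b ^ 3 - 3 * a\<^sup>2 * b + 2 * a ^ 3\<close>, with
    double root \<open>b = a\<close>. As the squares differ by 1, its nonnegativity says that
    \<open>2 / 3 * (b ^ 3 - a ^ 3)\<close> is at most the new summand \<open>b\<close>.\<close>
  have "0 \<le> (b - a)\<^sup>2 * (b + 2 * a)" using ab by simp
  also have "\<dots> = b * (b\<^sup>2 - a\<^sup>2) * 3 - 2 * (b ^ 3 - a ^ 3)"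
    by (simp add: power2_eq_square power3_eq_cube algebra_simps)
  finally have "2 * b ^ 3 \<le> 2 * a ^ 3 + 3 * b" using eq by simp
  then have "2 / 3 * (b\<^sup>2 * b) \<le> 2 / 3 * (a\<^sup>2 * a) + b"
    by (simp add: power2_eq_square power3_eq_cube)
  moreover have "2 / 3 * (a\<^sup>2 * a) \<le> (\<Sum>l=1..n. sqrt (real l))"
    using Suc.IH by (simp add: a_def)
  moreover have "(\<Sum>l=1..Suc n. sqrt (real l)) = (\<Sum>l=1..n. sqrt (real l)) + b"
    by (simp add: b_def)
  moreover have "real (Suc n) * sqrt (real (Suc n)) = b\<^sup>2 * b"
    by (simp add: b_def)
  ultimately show ?case by linarith
qed simp

text \<open>Abel summation: the weights \<open>t\<close> grow by 1 at each step, so every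
  \<open>F t\<close> survives once, and the last weight leaves the boundary term.\<close>

lemma sum_weighted_diff:
  fixes F :: "nat \<Rightarrow> real"
  shows "(\<Sum>t=1..n. real t * (F t - F (Suc t))) = (\<Sum>t=1..n. F t) - real n * F (Suc n)"
  by (induction n) (auto simp: algebra_simps)

text \<open>The deterministic core. In the application \<open>a t\<close> is the expected squared
  gradient norm, \<open>F t\<close> the expected function value, \<open>C\<close> is
  \<open>L * V\<^sup>2\<close>, and \<open>D\<close> is the gap between the upper bound and the
  infimum of \<open>f\<close>.\<close>

lemma weighted_average_bound:
  fixes a F \<eta> :: "nat \<Rightarrow> real"
  assumes "\<eta>\<^sub>0 > 0" "T \<ge> 1" "C \<ge> 0"
    and \<eta>: "\<And>t. t \<in> {1..T} \<Longrightarrow> \<eta> t = \<eta>\<^sub>0 / sqrt (real t)"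
    and step: "\<And>t. t \<in> {1..T} \<Longrightarrow> \<eta> t / 2 * a t \<le> F t - F (Suc t) + C * (\<eta> t)\<^sup>2 / 2"
    and osc: "\<And>t. t \<in> {1..T} \<Longrightarrow> F t - F (Suc T) \<le> D" and "D \<ge> 0"
  shows "(\<Sum>t=1..T. (1 / \<eta> t) / (\<Sum>l=1..T. 1 / \<eta> l) * a t)
    \<le> (3 * D / \<eta>\<^sub>0 + 3 * C * \<eta>\<^sub>0 / 2) * (1 / sqrt (real T))"
proof -
  define W where "W = (\<Sum>l=1..T. 1 / \<eta> l)"
  define K where "K = T * (2 * D / \<eta>\<^sub>0\<^sup>2 + C)"
  have "K \<ge> 0" using assms by (simp add: K_def)
  have weighted: "1 / \<eta> t * a t \<le> 2 / \<eta>\<^sub>0\<^sup>2 * (t * (F t - F (Suc t))) + C" if "t \<in> {1..T}" for t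
  proof -
    have pos: "\<eta> t > 0" and inv: "1 / (\<eta> t)\<^sup>2 = t / \<eta>\<^sub>0\<^sup>2"
      using \<eta>[OF that] that \<open>\<eta>\<^sub>0 > 0\<close> by (auto simp: power_divide)
    have "1 / \<eta> t * a t = 2 * (1 / (\<eta> t)\<^sup>2) * (\<eta> t / 2 * a t)"
      using pos by (simp add: power2_eq_square)
    also have "\<dots> \<le> 2 * (1 / (\<eta> t)\<^sup>2) * (F t - F (Suc t) + C * (\<eta> t)\<^sup>2 / 2)"
      using step[OF that] by (intro mult_left_mono) auto
    also have "\<dots> = 2 * (1 / (\<eta> t)\<^sup>2) * (F t - F (Suc t)) + C"
      using pos by (simp add: field_simps)
    also have "\<dots> = 2 / \<eta>\<^sub>0\<^sup>2 * (t * (F t - F (Suc t))) + C"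
      unfolding inv by simp
    finally show ?thesis .
  qed
  have "(\<Sum>t=1..T. 1 / \<eta> t * a t) \<le> (\<Sum>t=1..T. 2 / \<eta>\<^sub>0\<^sup>2 * (t * (F t - F (Suc t))) + C)"
    by (rule sum_mono) (rule weighted)
  \<comment> \<open>After summation by parts only differences to the final value
    \<open>F (Suc T)\<close> remain, each bounded by \<open>D\<close> through
    \<open>osc\<close>.\<close>
  also have "\<dots> = 2 / \<eta>\<^sub>0\<^sup>2 * (\<Sum>t=1..T. F t - F (Suc T)) + T * C"
    unfolding sum.distrib sum_distrib_left[symmetric] sum_weighted_diff
    by (simp add: sum_subtractf)
  also have "(\<Sum>t=1..T. F t - F (Suc T)) \<le> T * D"
    using sum_mono[OF osc, of "{1..T}" "\<lambda>t. t"] by simp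
  finally have num: "(\<Sum>t=1..T. 1 / \<eta> t * a t) \<le> K"
    by (simp add: K_def algebra_simps mult_left_mono divide_right_mono)
  have "W = (\<Sum>l=1..T. sqrt l) / \<eta>\<^sub>0"
    unfolding W_def sum_divide_distrib by (rule sum.cong) (auto simp: \<eta>)
  then have W: "2 / 3 * (T * sqrt T) / \<eta>\<^sub>0 \<le> W"
    using sum_sqrt_ge[of T] \<open>\<eta>\<^sub>0 > 0\<close> by (simp add: divide_right_mono del: times_divide_eq_left)
  have low: "0 < 2 / 3 * (T * sqrt T) / \<eta>\<^sub>0" using assms by simp
  have "(\<Sum>t=1..T. (1 / \<eta> t) / W * a t) = (\<Sum>t=1..T. 1 / \<eta> t * a t) / W"
    by (simp add: sum_divide_distrib)
  also have "\<dots> \<le> K / W"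
    using num low W by (intro divide_right_mono) auto
  \<comment> \<open>Replacing \<open>W\<close> by its lower bound enlarges the quotient because
    \<open>K\<close> is nonnegative, which is what \<open>D \<ge> 0\<close> and
    \<open>C \<ge> 0\<close> ensure.\<close>
  also have "\<dots> \<le> K / (2 / 3 * (T * sqrt T) / \<eta>\<^sub>0)"
    by (rule divide_left_mono[OF W \<open>K \<ge> 0\<close>], rule mult_pos_pos) (use W low in linarith)+
  also have "\<dots> = (3 * D / \<eta>\<^sub>0 + 3 * C * \<eta>\<^sub>0 / 2) * (1 / sqrt (real T))"
    using assms by (simp add: K_def field_simps power2_eq_square)
  finally show ?thesis unfolding W_def .
qed

section \<open>Convergence of SGD at the randomly drawn iterate\<close>

text \<open>The bound in \<open>f_max\<close> alone is stated for nonnegative \<open>f\<close>: for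
  the constant function -1 with \<open>f_max = -1\<close> and \<open>V = 0\<close> its right side is
  negative while the left side is 0. The version with \<open>f_max - (INF y. f y)\<close> is
  invariant under adding constants to \<open>f\<close> and covers every \<open>f\<close> bounded
  below. Integrability is part of the claim because the Bochner integral of a non-integrable
  function is 0 by convention.\<close>

theorem theorem3p5:
  fixes f :: "real ^ 'd \<Rightarrow> real"
    and L V \<eta>\<^sub>0 f_max :: real
    and T :: nat
    and M :: "'w measure"
    and x g :: "nat \<Rightarrow> 'w \<Rightarrow> real ^ 'd"
    and x\<^sub>1 :: "real ^ 'd"
    and \<eta> :: "nat \<Rightarrow> real"
    and \<tau> :: "'w \<Rightarrow> nat"
  assumes "prob_space M"
    and "L > 0" and "L_smooth L f"
    and "bdd_below (range f)"
    and "\<And>y. f y \<le> f_max"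
    and "T \<ge> 1" and "\<eta>\<^sub>0 > 0"
    and "\<And>t. t \<in> {1..T} \<Longrightarrow> \<eta> t = \<eta>\<^sub>0 / sqrt (real t)"
    and "\<And>t. t \<in> {1..T} \<Longrightarrow> \<eta> t \<le> 1 / L"
    and "\<And>\<omega>. \<omega> \<in> space M \<Longrightarrow> x 1 \<omega> = x\<^sub>1"
    and "\<And>t \<omega>. t \<in> {1..T} \<Longrightarrow> \<omega> \<in> space M \<Longrightarrow> x (Suc t) \<omega> = x t \<omega> - \<eta> t *\<^sub>R g t \<omega>"
    and "unbiased_oracle M f x g T"
    and "variance_bounded_oracle M g T (V\<^sup>2)"
    and "independent_index M g T (\<lambda>t. (1 / \<eta> t) / (\<Sum>l=1..T. 1 / \<eta> l)) \<tau>"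
  shows "integrable M (\<lambda>\<omega>. (norm (grad f (x (\<tau> \<omega>) \<omega>)))\<^sup>2) \<and>
    ((\<forall>y. 0 \<le> f y) \<longrightarrow>
      (\<integral>\<omega>. (norm (grad f (x (\<tau> \<omega>) \<omega>)))\<^sup>2 \<partial>M)
        \<le> (3 * f_max / \<eta>\<^sub>0 + 3 * L * V\<^sup>2 * \<eta>\<^sub>0 / 2) * (1 / sqrt (real T))) \<and>
    (\<integral>\<omega>. (norm (grad f (x (\<tau> \<omega>) \<omega>)))\<^sup>2 \<partial>M)
      \<le> (3 * (f_max - (INF y. f y)) / \<eta>\<^sub>0 + 3 * L * V\<^sup>2 * \<eta>\<^sub>0 / 2) * (1 / sqrt (real T))"
proof -
  note smooth = assms(3) assms(2) and \<eta> = assms(8) and init = assms(10) and upd = assms(11)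
  define m where "m = (INF y. f y)"
  have low: "m \<le> f y" for y
    unfolding m_def by (rule cINF_lower) (use assms(4) in auto)
  interpret prob_space M by fact
  have [measurable]: "f \<in> borel_measurable borel" "grad f \<in> borel_measurable borel"
    using L_smooth_continuous_on[OF smooth(1)] L_smooth_continuous_on_grad[OF smooth]
    by (auto intro: borel_measurable_continuous_onI)
  have g: "integrable M (g t)"
    and mean: "AE \<omega> in M. vec_cond_exp M (past M g t) (g t) \<omega> = grad f (x t \<omega>)"
    if "t \<in> {1..T}" for t
    using assms(12) that by (auto simp: unbiased_oracle_def)
  have gM: "g t \<in> borel_measurable M" if "t \<in> {1..T}" for t
    using g[OF that] by simp
  have sub: "subalgebra M (past M g t)" if "t \<in> {1..Suc T}" for t
    by (rule subalgebra_past) (use gM that in auto)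
  have x: "x t \<in> borel_measurable (past M g t)" if "t \<in> {1..Suc T}" for t
    by (rule iterate_measurable_past[OF init upd that])
  have xM [measurable]: "x t \<in> borel_measurable M" if "t \<in> {1..Suc T}" for t
    using sub[OF that] x[OF that] by (rule measurable_from_subalg)
  \<comment> \<open>The index is independent of all \<open>T\<close> answers jointly, so all
    iterates are viewed in the one sigma-algebra \<open>past M g (Suc T)\<close>.\<close>
  have xT: "x t \<in> borel_measurable (past M g (Suc T))" if "t \<in> {1..Suc T}" for t
    using subalgebra_past_mono x[OF that] by (rule measurable_from_subalg) (use that in auto)
  define Z where "Z t \<omega> = (norm (grad f (x t \<omega>)))\<^sup>2" for t \<omega>
  have ZT: "Z t \<in> borel_measurable (past M g (Suc T))" if "t \<in> {1..T}" for t
  proof -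
    have [measurable]: "x t \<in> borel_measurable (past M g (Suc T))" using xT that by auto
    show ?thesis unfolding Z_def by measurable
  qed
  have Zint: "integrable M (Z t)" if "t \<in> {1..T}" for t
  proof (rule integrable_const_bound[where B = "2 * L * (f_max - m)"])
    have [measurable]: "x t \<in> borel_measurable M" using xM that by auto
    show "Z t \<in> borel_measurable M" unfolding Z_def by measurable
    show "AE \<omega> in M. norm (Z t \<omega>) \<le> 2 * L * (f_max - m)"
      using L_smooth_grad_bound[OF smooth low assms(5)] by (simp add: Z_def)
  qed
  have idx: "integrable M (\<lambda>\<omega>. Z (\<tau> \<omega>) \<omega>)"
    "(\<integral>\<omega>. Z (\<tau> \<omega>) \<omega> \<partial>M)
      = (\<Sum>t=1..T. (1 / \<eta> t) / (\<Sum>l=1..T. 1 / \<eta> l) * (\<integral>\<omega>. Z t \<omega> \<partial>M))"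
    by (rule independent_index_expectation[OF assms(1) assms(14)]; use gM ZT Zint in blast)+
  define F where "F t = (\<integral>\<omega>. f (x t \<omega>) \<partial>M)" for t
  have fint: "integrable M (\<lambda>\<omega>. f (x t \<omega>))" if "t \<in> {1..Suc T}" for t
  proof (rule integrable_const_bound[where B = "\<bar>m\<bar> + \<bar>f_max\<bar>"])
    have "\<bar>f y\<bar> \<le> \<bar>m\<bar> + \<bar>f_max\<bar>" for y using low[of y] assms(5)[of y] by linarith
    then show "AE \<omega> in M. norm (f (x t \<omega>)) \<le> \<bar>m\<bar> + \<bar>f_max\<bar>" by simp
    have [measurable]: "x t \<in> borel_measurable M" using xM that by auto
    show "(\<lambda>\<omega>. f (x t \<omega>)) \<in> borel_measurable M" by measurable
  qed
  have F: "m \<le> F t" "F t \<le> f_max" if "t \<in> {1..Suc T}" for t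
    unfolding F_def using integral_mono[of M "\<lambda>_. m", OF _ fint[OF that]]
      integral_mono[of M _ "\<lambda>_. f_max", OF fint[OF that]] low assms(5)
    by (auto simp: prob_space)
  have step: "\<eta> t / 2 * (\<integral>\<omega>. Z t \<omega> \<partial>M) \<le> F t - F (Suc t) + L * V\<^sup>2 * (\<eta> t)\<^sup>2 / 2"
    if t: "t \<in> {1..T}" for t
  proof -
    have var: "AE \<omega> in M. nn_cond_exp M (past M g t)
        (\<lambda>\<omega>'. ennreal ((norm (g t \<omega>' - vec_cond_exp M (past M g t) (g t) \<omega>'))\<^sup>2)) \<omega> \<le> ennreal (V\<^sup>2)"
      using assms(13) t by (auto simp: variance_bounded_oracle_def)
    \<comment> \<open>The update rule identifies the expected value after the step with the integral
      in \<open>expected_descent\<close>.\<close>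
    have "F (Suc t) = (\<integral>\<omega>. f (x t \<omega> - \<eta> t *\<^sub>R g t \<omega>) \<partial>M)"
      unfolding F_def by (rule Bochner_Integration.integral_cong) (simp_all add: upd[OF t])
    moreover have "\<eta> t / 2 * (\<integral>\<omega>. Z t \<omega> \<partial>M) \<le> F t
        - (\<integral>\<omega>. f (x t \<omega> - \<eta> t *\<^sub>R g t \<omega>) \<partial>M) + L * (\<eta> t)\<^sup>2 * V\<^sup>2 / 2"
      unfolding Z_def F_def
      by (rule expected_descent[OF assms(1) sub smooth low assms(5) x g mean var])
        (use t \<eta> assms in auto)
    ultimately show ?thesis by (simp add: mult_ac)
  qed
  have "m \<le> f_max" using low[of 0] assms(5)[of 0] by simp
  have bound: "(\<integral>\<omega>. Z (\<tau> \<omega>) \<omega> \<partial>M)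
      \<le> (3 * (f_max - m) / \<eta>\<^sub>0 + 3 * (L * V\<^sup>2) * \<eta>\<^sub>0 / 2) * (1 / sqrt (real T))"
    unfolding idx(2)
  proof (rule weighted_average_bound[OF assms(7) assms(6) _ \<eta> step])
    \<comment> \<open>The upper bound is used at time \<open>t\<close>, the lower bound at the point
      after the last update.\<close>
    show "F t - F (Suc T) \<le> f_max - m" if "t \<in> {1..T}" for t
      using F(2)[of t] F(1)[of "Suc T"] that by auto
  qed (use \<open>L > 0\<close> \<open>m \<le> f_max\<close> in auto)
  \<comment> \<open>For nonnegative \<open>f\<close> the infimum \<open>m\<close> is nonnegative, so
    dropping it from \<open>f_max - m\<close> only weakens the bound.\<close>
  have "m \<ge> 0" if "\<forall>y. 0 \<le> f y"
    unfolding m_def by (rule cINF_greatest) (use that in auto)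
  then have "(3 * (f_max - m) / \<eta>\<^sub>0 + 3 * (L * V\<^sup>2) * \<eta>\<^sub>0 / 2) * (1 / sqrt (real T))
      \<le> (3 * f_max / \<eta>\<^sub>0 + 3 * (L * V\<^sup>2) * \<eta>\<^sub>0 / 2) * (1 / sqrt (real T))" if "\<forall>y. 0 \<le> f y"
    using that \<open>\<eta>\<^sub>0 > 0\<close> by (intro mult_right_mono add_right_mono divide_right_mono) auto
  with idx(1) bound show ?thesis
    unfolding Z_def m_def by (auto simp: mult.assoc intro: order_trans)
qed

end
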